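(* Let $P$ be a finite bounded poset with minimum element $\hat 0$ and maximum element $\hat 1$, $\hat 0\ne\hat 1$. Let $Q$ be the quiver resulting from adding the directed edge $\hat 0\to\hat 1$ to the Hasse diagram $H(P)$. Then for the toric poset $[Q]$, $$\Psi_{\rm tor}^{[Q]}(\mathbf{x})=\frac{1}{x_{\hat 1}-x_{\hat 0}}\,\Psi^{P}(\mathbf{x}).$$
   Context: The Hasse diagram $H(P)$ is the quiver with an arc $i\to j$ for each cover relation $i\lessdot_P j$. (Quivers are simple, so if $\hat 0\to\hat 1$ is already in $H(P)$ then $Q=H(P)$.) Greene's rational function of a poset $P$ with $n$ elements is $\Psi^P(\mathbf{x})=\sum_{w\in\mathcal{L}(P)}\dfrac{1}{(x_{w_1}-x_{w_2})(x_{w_2}-x_{w_3})\cdots(x_{w_{n-1}}-x_{w_n})}$, where $\mathcal{L}(P)$ is the set of linear extensions $w=(w_1,\dots,w_n)$ of $P$ and $\mathbf{x}=(x_v)_{v\in P}$ are indeterminates. All quivers are finite directed graphs that are simple (no loops, no parallel or anti-parallel arcs) and acyclic, on a finite vertex set $V$ with $|V|=n$. A source is a vertex all of whose incident arcs point away from it; a sink is a vertex all of whose incident arcs point into it (an isolated vertex is both). A flip at a source or sink $k$ reverses all arcs incident to $k$. Two acyclic quivers are equivalent if they are related by a finite sequence of flips; the equivalence class $[Q]$ is called a toric poset; all its members have the same underlying undirected graph. A toric total order $[w]=[(w_1,\dots,w_n)]$ is the equivalence class of a permutation of $V$ under cyclic rotation. For a graph $G$ on $V$, let $\mathcal{A}_{\rm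 tor}(G)$ be the image in $\mathbb{R}^V/\mathbb{Z}^V$ of $\bigcup_{\{i,j\}\in G}\{x_i=x_j\}\subset\mathbb{R}^V$. A point of $\mathbb{R}^V/\mathbb{Z}^V-\mathcal{A}_{\rm tor}(G)$ determines an acyclic orientation of $G$: $i\to j$ if $x_i \bmod 1< x_j \bmod 1$ (values in $[0,1)$), and $j\to i$ otherwise. For a toric poset $[Q]$ with underlying graph $G$, its toric chamber $c_{[Q]}$ is the set of points whose orientation lies in $[Q]$ (these sets are exactly the connected components of $\mathbb{R}^V/\mathbb{Z}^V-\mathcal{A}_{\rm tor}(G)$). For a toric total order $[w]$, $c_{[w]}$ is the set of points with pairwise distinct coordinates such that listing the indices in increasing order of $x_i\bmod 1$ gives a member of $[w]$. $[w]$ is a toric total extension of $[Q]$ if $c_{[w]}\subseteq c_{[Q]}$; the set of these is $\mathcal{L}_{\rm tor}([Q])$. Define $\Psi_{\rm tor}^{[Q]}(\mathbf{x})=\sum_{[w]\in\mathcal{L}_{\rm tor}([Q])}\Psi_{\rm tor}^{[w]}(\mathbf{x})$, where $\Psi_{\rm tor}^{[w]}(\mathbf{x})=\dfrac{1}{(x_{w_1}-x_{w_2})(x_{w_2}-x_{w_3})\cdots(x_{w_{n-1}}-x_{w_n})(x_{w_n}-x_{w_1})}$. *)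

theory Defs
  imports
    Complex_Main
    "HOL-Library.Poly_Mapping"
    "HOL-Library.FuncSet"
    "HOL-Computational_Algebra.Fraction_Field"
    "HOL-Combinatorics.Multiset_Permutations"
begin

section \<open>Rational functions in indeterminates indexed by a type\<close>

text \<open>
  Monomials and polynomials are the finitely supported functions of
  \<^theory>\<open>HOL-Library.Poly_Mapping\<close>. That theory proves the absence of zero divisors
  only for linearly ordered index types, so the indeterminates are indexed by a copy of the
  given type that carries some (arbitrarily chosen) linear order. The order plays no role in
  the ring structure.
\<close>

datatype 'v var = Var 'v

definition var_order :: "'v rel" where
  "var_order = (SOME r. well_order_on UNIV r)"

lemma well_order_on_var_order: "well_order_on UNIV var_order"
  unfolding var_order_def by (rule someI_ex) (rule well_order_on)

instantiation var :: (type) linorder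
begin

definition less_eq_var :: "'a var \<Rightarrow> 'a var \<Rightarrow> bool" where
  "less_eq_var a b \<longleftrightarrow> (case a of Var u \<Rightarrow> case b of Var v \<Rightarrow> (u, v) \<in> var_order)"

definition less_var :: "'a var \<Rightarrow> 'a var \<Rightarrow> bool" where
  "less_var a b \<longleftrightarrow> a \<le> b \<and> \<not> b \<le> a"

instance
proof
  have lin: "linear_order_on UNIV (var_order :: 'a rel)"
    using well_order_on_var_order unfolding well_order_on_def by blast
  have r: "(u, u) \<in> var_order" for u :: 'a
    using lin by (simp add: order_on_defs refl_on_def)
  have t: "trans (var_order :: 'a rel)" and as: "antisym (var_order :: 'a rel)"
    using lin by (simp_all add: order_on_defs)
  have tot: "(u, v) \<in> var_order \<or> (v, u) \<in> var_order" for u v :: 'a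
    using lin r by (cases "u = v") (auto simp: order_on_defs total_on_def)
  fix x y z :: "'a var"
  show "x < y \<longleftrightarrow> x \<le> y \<and> \<not> y \<le> x" by (rule less_var_def)
  show "x \<le> x" by (cases x) (simp add: less_eq_var_def r)
  show "x \<le> y \<Longrightarrow> y \<le> z \<Longrightarrow> x \<le> z"
    by (cases x; cases y; cases z) (auto simp: less_eq_var_def intro: transD[OF t])
  show "x \<le> y \<Longrightarrow> y \<le> x \<Longrightarrow> x = y"
    by (cases x; cases y) (auto simp: less_eq_var_def intro: antisymD[OF as])
  show "x \<le> y \<or> y \<le> x"
    using tot by (cases x; cases y) (auto simp: less_eq_var_def)
qed

end

type_synonym ('v, 'k) polynomial = "('v var \<Rightarrow>\<^sub>0 nat) \<Rightarrow>\<^sub>0 'k"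

type_synonym ('v, 'k) ratfun = "('v, 'k) polynomial fract"

definition indet :: "'v \<Rightarrow> ('v, 'k :: field) ratfun" where
  "indet v = Fraction_Field.Fract (Poly_Mapping.single (Poly_Mapping.single (Var v) 1) 1) 1"

lemma inj_indet: "inj (indet :: 'v \<Rightarrow> ('v, 'k :: field) ratfun)"
proof (rule injI)
  fix u v :: 'v
  assume "(indet u :: ('v, 'k) ratfun) = indet v"
  then have "Poly_Mapping.single (Poly_Mapping.single (Var u) (1 :: nat)) (1 :: 'k) =
      Poly_Mapping.single (Poly_Mapping.single (Var v) 1) 1"
    by (simp add: indet_def eq_fract)
  then have "Poly_Mapping.single (Var u) (1 :: nat) = Poly_Mapping.single (Var v) 1"
    by (metis lookup_single_eq lookup_single_not_eq one_neq_zero)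
  then show "u = v"
    by (metis lookup_single_eq lookup_single_not_eq one_neq_zero var.inject)
qed


section \<open>Posets and Greene's rational function\<close>

text \<open>
  A poset is a carrier \<open>V\<close> with a relation \<open>r\<close> such that \<^term>\<open>partial_order_on V r\<close>;
  the pair \<^term>\<open>(i, j) \<in> r\<close> stands for \<open>i \<le> j\<close>.
\<close>

definition hasse_diagram :: "'v rel \<Rightarrow> 'v rel" where
  "hasse_diagram r =
     {(i, j) \<in> r. i \<noteq> j \<and> \<not> (\<exists>k. k \<noteq> i \<and> k \<noteq> j \<and> (i, k) \<in> r \<and> (k, j) \<in> r)}"

definition linear_extensions :: "'v set \<Rightarrow> 'v rel \<Rightarrow> 'v list set" where
  "linear_extensions V r =
     {w \<in> permutations_of_set V.
        \<forall>a < length w. \<forall>b < length w. (w ! a, w ! b) \<in> r \<longrightarrow> a \<le> b}"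

definition greene :: "('v \<Rightarrow> 'k :: field) \<Rightarrow> 'v set \<Rightarrow> 'v rel \<Rightarrow> 'k" where
  "greene x V r =
     (\<Sum>w \<in> linear_extensions V r.
        1 / (\<Prod>i < length w - 1. x (w ! i) - x (w ! Suc i)))"


section \<open>Quivers, flips and toric posets\<close>

text \<open>
  A quiver on the vertex set \<open>V\<close> is given by its set of arcs, a relation \<open>E \<subseteq> V \<times> V\<close>.
  Being a set, it has no parallel arcs; loops and anti-parallel arcs are excluded
  by \<^term>\<open>acyclic E\<close>.
\<close>

definition is_source :: "'v set \<Rightarrow> 'v rel \<Rightarrow> 'v \<Rightarrow> bool" where
  "is_source V E k \<longleftrightarrow> k \<in> V \<and> (\<forall>i. (i, k) \<notin> E)"

definition is_sink :: "'v set \<Rightarrow> 'v rel \<Rightarrow> 'v \<Rightarrow> bool" where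
  "is_sink V E k \<longleftrightarrow> k \<in> V \<and> (\<forall>j. (k, j) \<notin> E)"

definition reverse_at :: "'v \<Rightarrow> 'v rel \<Rightarrow> 'v rel" where
  "reverse_at k E =
     {(i, j) \<in> E. i \<noteq> k \<and> j \<noteq> k} \<union> {(j, i) | i j. (i, j) \<in> E \<and> (i = k \<or> j = k)}"

definition flip_step :: "'v set \<Rightarrow> 'v rel \<Rightarrow> 'v rel \<Rightarrow> bool" where
  "flip_step V E E' \<longleftrightarrow> (\<exists>k. (is_source V E k \<or> is_sink V E k) \<and> E' = reverse_at k E)"

definition toric_poset :: "'v set \<Rightarrow> 'v rel \<Rightarrow> 'v rel set" where
  "toric_poset V E = {E'. (flip_step V)\<^sup>*\<^sup>* E E'}"

definition underlying_graph :: "'v rel \<Rightarrow> 'v set set" where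
  "underlying_graph E = {{i, j} | i j. (i, j) \<in> E}"

text \<open>All members of a toric poset have the same underlying graph, so this union is that graph.\<close>

definition toric_graph :: "'v rel set \<Rightarrow> 'v set set" where
  "toric_graph C = (\<Union>E \<in> C. underlying_graph E)"


section \<open>The torus and toric chambers\<close>

definition torus_rel :: "'v set \<Rightarrow> ('v \<Rightarrow> real) rel" where
  "torus_rel V =
     {(x, y). x \<in> V \<rightarrow>\<^sub>E UNIV \<and> y \<in> V \<rightarrow>\<^sub>E UNIV \<and> (\<forall>v \<in> V. x v - y v \<in> \<int>)}"

definition torus :: "'v set \<Rightarrow> ('v \<Rightarrow> real) set set" where
  "torus V = (V \<rightarrow>\<^sub>E UNIV) // torus_rel V"

definition toric_arrangement :: "'v set \<Rightarrow> 'v set set \<Rightarrow> ('v \<Rightarrow> real) set set" where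
  "toric_arrangement V G =
     (\<lambda>x. torus_rel V `` {x}) ` {x \<in> V \<rightarrow>\<^sub>E UNIV. \<exists>i j. {i, j} \<in> G \<and> x i = x j}"

text \<open>
  Only used at representatives of points off the arrangement, where exactly one of the two
  directions of each edge is chosen. The value depends only on the coordinates modulo 1.
\<close>

definition orientation :: "'v set set \<Rightarrow> ('v \<Rightarrow> real) \<Rightarrow> 'v rel" where
  "orientation G x = {(i, j). {i, j} \<in> G \<and> frac (x i) < frac (x j)}"

definition toric_chamber :: "'v set \<Rightarrow> 'v rel set \<Rightarrow> ('v \<Rightarrow> real) set set" where
  "toric_chamber V C =
     {p \<in> torus V - toric_arrangement V (toric_graph C).
        \<exists>x \<in> p. orientation (toric_graph C) x \<in> C}"


section \<open>Toric total orders and toric total extensions\<close>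

definition toric_order :: "'v list \<Rightarrow> 'v list set" where
  "toric_order w = {rotate m w | m. True}"

definition toric_total_orders :: "'v set \<Rightarrow> 'v list set set" where
  "toric_total_orders V = toric_order ` permutations_of_set V"

text \<open>
  Strict sortedness of \<open>u\<close>, which lists all of \<open>V\<close>, includes that the coordinates are pairwise
  distinct modulo 1.
\<close>

definition toric_order_chamber :: "'v set \<Rightarrow> 'v list set \<Rightarrow> ('v \<Rightarrow> real) set set" where
  "toric_order_chamber V W =
     {p \<in> torus V. \<exists>x \<in> p. \<exists>u \<in> W. sorted_wrt (\<lambda>i j. frac (x i) < frac (x j)) u}"

definition toric_total_extensions :: "'v set \<Rightarrow> 'v rel set \<Rightarrow> 'v list set set" where
  "toric_total_extensions V C =
     {W \<in> toric_total_orders V. toric_order_chamber V W \<subseteq> toric_chamber V C}"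


section \<open>Toric rational functions\<close>

definition cyclic_fraction :: "('v \<Rightarrow> 'k :: field) \<Rightarrow> 'v list \<Rightarrow> 'k" where
  "cyclic_fraction x w =
     1 / (\<Prod>i < length w. x (w ! i) - x (w ! (Suc i mod length w)))"

lemma cyclic_fraction_rotate: "cyclic_fraction x (rotate m w) = cyclic_fraction x w"
proof (cases "w = []")
  case False
  define n where "n = length w"
  have n: "n > 0" using False by (simp add: n_def)
  define f where "f i = x (w ! i) - x (w ! (Suc i mod n))" for i
  have eq: "x (rotate m w ! i) - x (rotate m w ! (Suc i mod n)) = f ((m + i) mod n)"
    if "i < n" for i
    using that n by (simp add: f_def nth_rotate n_def[symmetric] mod_simps)
  have inj: "inj_on (\<lambda>i. (m + i) mod n) {..<n}"
  proof (rule inj_onI)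
    fix i j assume ij: "i \<in> {..<n}" "j \<in> {..<n}" and "(m + i) mod n = (m + j) mod n"
    then have "rotate m [0..<n] ! i = rotate m [0..<n] ! j"
      by (simp add: nth_rotate)
    then show "i = j"
      using ij nth_eq_iff_index_eq[of "rotate m [0..<n]" i j] by simp
  qed
  have "(\<lambda>i. (m + i) mod n) ` {..<n} = {..<n}"
    by (rule endo_inj_surj) (use n inj in auto)
  then have "(\<Prod>i<n. f ((m + i) mod n)) = (\<Prod>i<n. f i)"
    using prod.reindex[OF inj, of f] by (simp add: comp_def)
  then show ?thesis
    by (simp add: cyclic_fraction_def n_def[symmetric] eq f_def[symmetric])
qed simp

text \<open>
  The fraction is invariant under rotation (lemma \<open>cyclic_fraction_rotate\<close>), so it has a single
  value on a toric total order.
\<close>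

definition toric_fraction :: "('v \<Rightarrow> 'k :: field) \<Rightarrow> 'v list set \<Rightarrow> 'k" where
  "toric_fraction x W = the_elem (cyclic_fraction x ` W)"

lemma toric_fraction_toric_order: "toric_fraction x (toric_order w) = cyclic_fraction x w"
proof -
  have "cyclic_fraction x ` toric_order w = {cyclic_fraction x w}"
  proof
    show "cyclic_fraction x ` toric_order w \<subseteq> {cyclic_fraction x w}"
      by (auto simp: toric_order_def cyclic_fraction_rotate)
    have "rotate 0 w \<in> toric_order w"
      unfolding toric_order_def by blast
    then show "{cyclic_fraction x w} \<subseteq> cyclic_fraction x ` toric_order w"
      by simp
  qed
  then show ?thesis by (simp add: toric_fraction_def)
qed

definition toric_greene :: "('v \<Rightarrow> 'k :: field) \<Rightarrow> 'v set \<Rightarrow> 'v rel set \<Rightarrow> 'k" where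
  "toric_greene x V C = (\<Sum>W \<in> toric_total_extensions V C. toric_fraction x W)"

end

theory Submission
  imports Defs
begin

text \<open>
  A sequence of flips carries a height function counting, at each vertex, its flips as a source
  minus its flips as a sink. Heights cannot increase along an arc of the original quiver, and an
  arc keeps its direction exactly when its two ends have the same height. If after the flips
  \<open>bmin\<close> is a source, then the arc \<open>bmin \<rightarrow> bmax\<close> forces \<open>bmin\<close> and \<open>bmax\<close> to have the same height;
  as every vertex lies on a chain between them, the height is constant and no arc has changed.
  So a toric total extension, cut open at \<open>bmin\<close>, is a linear extension. Conversely,
  rotating a linear extension by one place flips its first element from source to sink.
  The step from \<open>bmax\<close> back to \<open>bmin\<close> in the cyclic product is the factor
  \<open>1 / (x\<^bsub>bmax\<^esub> - x\<^bsub>bmin\<^esub>)\<close>.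
\<close>

section \<open>Finite posets and cover relations\<close>

lemma hasse_diagram_subset: "hasse_diagram r \<subseteq> r"
  by (auto simp: hasse_diagram_def)

text \<open>Induction on the number of elements strictly between \<open>i\<close> and
  \<open>j\<close>: if \<open>k\<close> is such an element, the intervals from \<open>i\<close> to
  \<open>k\<close> and from \<open>k\<close> to \<open>j\<close> both lie properly inside the old
  one, since neither contains \<open>k\<close>.\<close>

lemma hasse_diagram_rtrancl:
  assumes "finite r" "trans r" "antisym r" "(i, j) \<in> r"
  shows "(i, j) \<in> (hasse_diagram r)\<^sup>*"
  using assms(4)
proof (induction "card {k. k \<noteq> i \<and> k \<noteq> j \<and> (i, k) \<in> r \<and> (k, j) \<in> r}"
    arbitrary: i j rule: less_induct)
  case less
  let ?I = "\<lambda>i j. {k. k \<noteq> i \<and> k \<noteq> j \<and> (i, k) \<in> r \<and> (k, j) \<in> r}"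
  show ?case
  proof (cases "i = j \<or> (i, j) \<in> hasse_diagram r")
    case False
    then obtain k where k: "k \<noteq> i" "k \<noteq> j" "(i, k) \<in> r" "(k, j) \<in> r"
      using less.prems unfolding hasse_diagram_def by blast
    have "?I i k \<subset> ?I i j" "?I k j \<subset> ?I i j"
      using k assms(2,3) by (auto dest: transD antisymD)
    moreover have "finite (?I i j)"
      by (rule finite_subset[of _ "Range r"]) (auto simp: assms(1) finite_Range)
    ultimately have "(i, k) \<in> (hasse_diagram r)\<^sup>*" "(k, j) \<in> (hasse_diagram r)\<^sup>*"
      using less.hyps k(3,4) psubset_card_mono by blast+
    then show ?thesis by simp
  qed auto
qed

section \<open>Flips\<close>

lemma underlying_graph_reverse_at: "underlying_graph (reverse_at k E) = underlying_graph E"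
proof -
  have iff: "{i, j} \<in> underlying_graph E \<longleftrightarrow> (i, j) \<in> E \<or> (j, i) \<in> E" for i j and E :: "'a rel"
    by (auto simp: underlying_graph_def doubleton_eq_iff)
  have mono: "underlying_graph E \<subseteq> underlying_graph E'"
    if "\<And>i j. (i, j) \<in> E \<Longrightarrow> (i, j) \<in> E' \<or> (j, i) \<in> E'" for E E' :: "'a rel"
  proof
    fix e assume "e \<in> underlying_graph E"
    then obtain i j where "e = {i, j}" "(i, j) \<in> E" by (auto simp: underlying_graph_def)
    then show "e \<in> underlying_graph E'" using that iff by simp
  qed
  show ?thesis
    by (intro equalityI mono) (auto simp: reverse_at_def)
qed

lemma toric_graph_toric_poset: "toric_graph (toric_poset V E) = underlying_graph E"
proof -
  have "underlying_graph E' = underlying_graph E" if "(flip_step V)\<^sup>*\<^sup>* E E'" for E'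
    using that
  proof (induction rule: rtranclp_induct)
    case (step E1 E2)
    then obtain k where "E2 = reverse_at k E1" unfolding flip_step_def by blast
    with step.IH show ?case by (simp only: underlying_graph_reverse_at)
  qed (rule refl)
  then have "\<forall>E' \<in> toric_poset V E. underlying_graph E' = underlying_graph E"
    unfolding toric_poset_def by blast
  moreover have "E \<in> toric_poset V E" by (simp add: toric_poset_def)
  ultimately show ?thesis unfolding toric_graph_def by blast
qed

text \<open>Flips at one end of an arc must alternate with flips at the other, so the heights of its
  ends never differ by more than one, and the difference records the current direction of the
  arc.\<close>

lemma toric_poset_height:
  assumes "E' \<in> toric_poset V E"
  obtains f :: "'v \<Rightarrow> int" where
    "\<And>i j. (i, j) \<in> E \<Longrightarrow> f i = f j \<and> (i, j) \<in> E' \<or> f i = f j + 1 \<and> (j, i) \<in> E'"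
proof -
  have "(flip_step V)\<^sup>*\<^sup>* E E'" using assms by (simp add: toric_poset_def)
  then have "\<exists>f :: 'v \<Rightarrow> int. \<forall>i j. (i, j) \<in> E \<longrightarrow>
      f i = f j \<and> (i, j) \<in> E' \<or> f i = f j + 1 \<and> (j, i) \<in> E'"
  proof induction
    case base
    show ?case by (rule exI[of _ "\<lambda>_. 0"]) simp
  next
    case (step E1 E2)
    then obtain f :: "'v \<Rightarrow> int" and k where
      f: "\<And>i j. (i, j) \<in> E \<Longrightarrow> f i = f j \<and> (i, j) \<in> E1 \<or> f i = f j + 1 \<and> (j, i) \<in> E1"
      and k: "is_source V E1 k \<or> is_sink V E1 k" and E2: "E2 = reverse_at k E1"
      unfolding flip_step_def by blast
    \<comment> \<open>A vertex that is both source and sink meets no arc of \<open>E1\<close>, hence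
      none of \<open>E\<close>, so the choice of sign is harmless there.\<close>
    define d :: int where "d = (if is_source V E1 k then 1 else -1)"
    have "(f(k := f k + d)) i = (f(k := f k + d)) j \<and> (i, j) \<in> E2 \<or>
        (f(k := f k + d)) i = (f(k := f k + d)) j + 1 \<and> (j, i) \<in> E2"
      if "(i, j) \<in> E" for i j
      using f[OF that] k
      by (cases "i = k"; cases "j = k")
         (auto simp: E2 d_def reverse_at_def is_source_def is_sink_def)
    then show ?case by blast
  qed
  then show thesis using that by blast
qed

section \<open>The orientation of a graph along a list\<close>

text \<open>Every edge between listed vertices points to the later one. Recursion on the head shows
  at once that the head is a source when the list is distinct.\<close>

fun list_orientation :: "'v set set \<Rightarrow> 'v list \<Rightarrow> 'v rel" where
  "list_orientation G [] = {}"
| "list_orientation G (v # u) = {(v, j) | j. j \<in> set u \<and> {v, j} \<in> G} \<union> list_orientation G u"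

lemma list_orientation_subset: "list_orientation G u \<subseteq> set u \<times> set u"
  by (induction u) auto

lemma list_orientation_snoc:
  "list_orientation G (u @ [v]) = list_orientation G u \<union> {(i, v) | i. i \<in> set u \<and> {i, v} \<in> G}"
  by (induction u) auto

text \<open>Serves twice: with \<open>E\<close> the orientation read off a point of the torus, and
  with \<open>E = Q\<close> along a linear extension.\<close>

lemma list_orientation_eq:
  assumes "sorted_wrt (\<lambda>i j. (j, i) \<notin> E) u" "irrefl E"
    and "\<And>i j. i \<in> set u \<Longrightarrow> j \<in> set u \<Longrightarrow> i \<noteq> j \<Longrightarrow> {i, j} \<in> G \<longleftrightarrow> (i, j) \<in> E \<or> (j, i) \<in> E"
    and "distinct u"
  shows "list_orientation G u = E \<inter> set u \<times> set u"
  using assms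
proof (induction u)
  case (Cons v u)
  then have "list_orientation G u = E \<inter> set u \<times> set u" by auto
  moreover have "{v, j} \<in> G \<longleftrightarrow> (v, j) \<in> E" if "j \<in> set u" for j
    using Cons.prems(1,4) Cons.prems(3)[of v j] that by auto
  moreover have "(j, v) \<notin> E" if "j \<in> set (v # u)" for j
    using Cons.prems(1,2) that by (auto simp: irrefl_def)
  ultimately show ?case by auto
qed simp

text \<open>The head is a source; sent to the end it becomes a sink, and only its own arcs are
  reversed. This is the flip at the head.\<close>

lemma flip_step_rotate1:
  assumes "distinct u" "set u \<subseteq> V" "u \<noteq> []"
  shows "flip_step V (list_orientation G u) (list_orientation G (rotate1 u))"
proof (cases u)
  case (Cons v u')
  have v: "(i, v) \<notin> list_orientation G u'" "(v, i) \<notin> list_orientation G u'" for i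
    using assms(1) list_orientation_subset[of G u'] by (auto simp: Cons)
  have "is_source V (list_orientation G u) v"
    using v assms by (auto simp: is_source_def Cons)
  moreover have "list_orientation G (rotate1 u) = reverse_at v (list_orientation G u)"
    using v assms(1)
    by (auto simp: Cons list_orientation_snoc reverse_at_def insert_commute)
  ultimately show ?thesis unfolding flip_step_def by blast
qed (use assms in simp)

lemma list_orientation_rotate_in_toric_poset:
  assumes "distinct u" "set u \<subseteq> V"
  shows "list_orientation G (rotate m u) \<in> toric_poset V (list_orientation G u)"
proof (cases "u = []")
  case False
  have "(flip_step V)\<^sup>*\<^sup>* (list_orientation G u) (list_orientation G (rotate m u))"
  proof (induction m)
    case (Suc m)
    then show ?case
      using flip_step_rotate1[of "rotate m u" V G] assms False
      by (simp add: rotate_Suc rtranclp.rtrancl_into_rtrancl)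
  qed simp
  then show ?thesis by (simp add: toric_poset_def)
qed (simp add: toric_poset_def)

section \<open>Points of the torus\<close>

lemma torus_mem_frac_eq:
  assumes "p \<in> torus V" "x \<in> p" "y \<in> p" "v \<in> V"
  shows "frac (x v) = frac (y v)"
proof -
  obtain z where "p = torus_rel V `` {z}"
    using assms(1) by (auto simp: torus_def elim: quotientE)
  then have "z v - x v \<in> \<int>" "z v - y v \<in> \<int>"
    using assms by (auto simp: torus_rel_def)
  then obtain m n :: int where "z v - x v = of_int m" "z v - y v = of_int n"
    by (auto elim!: Ints_cases)
  then have "x v = y v + of_int (n - m)" by simp
  then show ?thesis by (simp add: frac_def)
qed

lemma self_mem_torus_class:
  "x \<in> V \<rightarrow>\<^sub>E UNIV \<Longrightarrow> x \<in> torus_rel V `` {x} \<and> torus_rel V `` {x} \<in> torus V"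
  unfolding torus_def by (auto intro: quotientI) (simp add: torus_rel_def)

text \<open>Shows that the chamber of a toric order has a point sorted along each of its
  representatives, so that an inclusion of chambers says something about every rotation.\<close>

lemma ex_point_sorted_along:
  assumes "u \<in> permutations_of_set V"
  obtains x :: "'v \<Rightarrow> real" where "x \<in> V \<rightarrow>\<^sub>E UNIV" "sorted_wrt (\<lambda>i j. frac (x i) < frac (x j)) u"
proof -
  define n where "n = length u"
  have u: "distinct u" "set u = V" using assms by (auto simp: permutations_of_set_def)
  \<comment> \<open>The vertex at position \<open>a\<close> gets the coordinate
    \<open>a / n\<close>, which lies in [0,1) and thus equals its fractional part.\<close>
  define x where "x = (\<lambda>v\<in>V. real (inv_into {..<n} ((!) u) v) / real n)"
  have "inj_on ((!) u) {..<n}" using u by (auto simp: inj_on_def n_def nth_eq_iff_index_eq)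
  then have x: "x (u ! a) = real a / real n" if "a < n" for a
    using that u nth_mem[of a u] by (auto simp: x_def n_def)
  have "frac (x (u ! a)) = real a / real n" if "a < n" for a
    using that by (simp add: x frac_eq)
  then have "sorted_wrt (\<lambda>i j. frac (x i) < frac (x j)) u"
    by (auto simp: sorted_wrt_iff_nth_less n_def[symmetric] divide_strict_right_mono)
  then show thesis using that[of x] by (auto simp: x_def)
qed

lemma sorted_wrt_frac_neq:
  assumes "sorted_wrt (\<lambda>i j. frac (x i) < frac (x j)) u" "i \<in> set u" "j \<in> set u" "i \<noteq> j"
  shows "frac (x i) \<noteq> frac (x j)"
  using assms by (induction u) auto

lemma orientation_eq_list_orientation:
  assumes "sorted_wrt (\<lambda>i j. frac (x i) < frac (x j)) u" "distinct u"
    and "\<And>i j. {i, j} \<in> G \<Longrightarrow> i \<in> set u"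
  shows "orientation G x = list_orientation G u"
proof -
  have "list_orientation G u = orientation G x \<inter> set u \<times> set u"
  proof (rule list_orientation_eq)
    show "sorted_wrt (\<lambda>i j. (j, i) \<notin> orientation G x) u"
      by (rule sorted_wrt_mono_rel[OF _ assms(1)]) (auto simp: orientation_def)
    show "{i, j} \<in> G \<longleftrightarrow> (i, j) \<in> orientation G x \<or> (j, i) \<in> orientation G x"
      if "i \<in> set u" "j \<in> set u" "i \<noteq> j" for i j
      using sorted_wrt_frac_neq[OF assms(1) that] by (auto simp: orientation_def insert_commute)
  qed (use assms(2) in \<open>auto simp: orientation_def irrefl_def\<close>)
  moreover have "orientation G x \<subseteq> set u \<times> set u"
    using assms(3) by (fastforce simp: orientation_def insert_commute)
  ultimately show ?thesis by auto
qed

text \<open>Turns the geometric condition into a combinatorial one: all points sorted along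
  \<open>u\<close> induce the same orientation, namely the one along \<open>u\<close>, and such
  points exist.\<close>

lemma toric_order_chamber_subset_iff:
  fixes V :: "'v set"
  assumes "W \<subseteq> permutations_of_set V" "C = toric_poset V E" "E \<subseteq> V \<times> V" "irrefl E"
  shows "toric_order_chamber V W \<subseteq> toric_chamber V C \<longleftrightarrow>
    (\<forall>u \<in> W. list_orientation (underlying_graph E) u \<in> C)"
proof -
  let ?G = "underlying_graph E"
  have G: "toric_graph C = ?G" by (simp add: assms(2) toric_graph_toric_poset)
  have GV: "i \<in> V \<and> j \<in> V \<and> i \<noteq> j" if "{i, j} \<in> ?G" for i j
    using that assms(3,4) by (auto simp: underlying_graph_def doubleton_eq_iff irrefl_def)
  have W: "distinct u" "set u = V" if "u \<in> W" for u
    using that assms(1) by (auto simp: permutations_of_set_def)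
  have ori: "orientation ?G x = list_orientation ?G u"
    if "sorted_wrt (\<lambda>i j. frac (x i) < frac (x j)) u" "u \<in> W" for x u
    using that by (intro orientation_eq_list_orientation) (auto simp: W dest: GV)
  show ?thesis
  proof safe
    fix u assume sub: "toric_order_chamber V W \<subseteq> toric_chamber V C" and u: "u \<in> W"
    obtain x :: "'v \<Rightarrow> real" where
      x: "x \<in> V \<rightarrow>\<^sub>E UNIV" "sorted_wrt (\<lambda>i j. frac (x i) < frac (x j)) u"
      using ex_point_sorted_along u assms(1) by blast
    let ?p = "torus_rel V `` {x}"
    have p: "x \<in> ?p" "?p \<in> torus V" using self_mem_torus_class[OF x(1)] by auto
    then have "?p \<in> toric_chamber V C"
      using sub u x(2) unfolding toric_order_chamber_def by blast
    then obtain y where y: "y \<in> ?p" "orientation ?G y \<in> C"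
      by (auto simp: toric_chamber_def G)
    \<comment> \<open>Membership in the chamber speaks of some representative \<open>y\<close> only;
      orientations depend on fractional parts, which agree on the whole class.\<close>
    have "orientation ?G y = orientation ?G x"
      using torus_mem_frac_eq[OF p(2) p(1) y(1)] GV by (fastforce simp: orientation_def)
    then show "list_orientation ?G u \<in> C" using ori[OF x(2) u] y(2) by simp
  next
    fix p assume C: "\<forall>u \<in> W. list_orientation ?G u \<in> C" and "p \<in> toric_order_chamber V W"
    then obtain x u where p: "p \<in> torus V" and x: "x \<in> p" and u: "u \<in> W"
      and s: "sorted_wrt (\<lambda>i j. frac (x i) < frac (x j)) u"
      by (auto simp: toric_order_chamber_def)
    \<comment> \<open>On the arrangement, two adjacent vertices would share a fractional part,
      against strict sortedness along \<open>u\<close>.\<close>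
    have "p \<notin> toric_arrangement V ?G"
    proof
      assume "p \<in> toric_arrangement V ?G"
      then obtain y i j where y: "y \<in> V \<rightarrow>\<^sub>E UNIV" "p = torus_rel V `` {y}"
        and ij: "{i, j} \<in> ?G" "y i = y j"
        by (auto simp: toric_arrangement_def)
      have "frac (x v) = frac (y v)" if "v \<in> V" for v
        using torus_mem_frac_eq[OF p x _ that] self_mem_torus_class[OF y(1)] y(2) by simp
      then show False using sorted_wrt_frac_neq[OF s, of i j] GV[OF ij(1)] ij(2) W[OF u] by auto
    qed
    moreover have "orientation ?G x \<in> C" using ori[OF s u] bspec[OF C u] by simp
    ultimately show "p \<in> toric_chamber V C"
      using p x unfolding toric_chamber_def G by blast
  qed
qed

section \<open>Cutting cyclic orders open\<close>

lemma toric_order_subset_permutations: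
  "w \<in> permutations_of_set V \<Longrightarrow> toric_order w \<subseteq> permutations_of_set V"
  by (auto simp: toric_order_def permutations_of_set_def)

lemma self_mem_toric_order: "w \<in> toric_order w"
  by (auto simp: toric_order_def intro: exI[of _ 0])

lemma toric_order_rotate: "toric_order (rotate m w) = toric_order w"
proof
  show "toric_order (rotate m w) \<subseteq> toric_order w"
    by (auto simp: toric_order_def rotate_rotate)
  show "toric_order w \<subseteq> toric_order (rotate m w)"
  proof
    fix u assume "u \<in> toric_order w"
    then obtain k where k: "u = rotate k w" by (auto simp: toric_order_def)
    \<comment> \<open>Rotating by \<open>m * (length w - 1)\<close> undoes the rotation by
      \<open>m\<close>, as the two add up to a multiple of \<open>length w\<close>.\<close>
    have "u = rotate (k + m * (length w - 1)) (rotate m w)"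
    proof (cases w)
      case (Cons v w')
      then have eq: "k + m * (length w - 1) + m = k + m * length w" by simp
      show ?thesis
        unfolding k rotate_rotate eq by (metis mod_mult_self1 rotate_conv_mod)
    qed (simp add: k)
    then show "u \<in> toric_order (rotate m w)" by (auto simp: toric_order_def)
  qed
qed

lemma ex_rotate_hd:
  assumes "v \<in> set w"
  obtains m where "hd (rotate m w) = v"
proof -
  obtain m where "m < length w" "w ! m = v" using assms by (auto simp: in_set_conv_nth)
  then have "hd (rotate m w) = v"
    by (subst hd_rotate_conv_nth) auto
  then show thesis by (rule that)
qed

text \<open>A rotation of a nonempty distinct list that keeps the head is by a multiple of the
  length.\<close>

lemma toric_order_inj_hd:
  assumes "toric_order u = toric_order w" "hd u = hd w" "distinct w"
  shows "u = w"
proof (cases "w = []")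
  case True
  then show ?thesis using self_mem_toric_order[of u] assms(1) by (auto simp: toric_order_def)
next
  case False
  obtain m where m: "u = rotate m w"
    using self_mem_toric_order[of u] assms(1) by (auto simp: toric_order_def)
  then have "w ! (m mod length w) = w ! 0"
    using assms(2) False by (metis hd_rotate_conv_nth hd_conv_nth)
  then have "m mod length w = 0"
    using assms(3) False by (simp add: nth_eq_iff_index_eq)
  then show ?thesis by (metis m rotate_conv_mod rotate0 id_apply)
qed

text \<open>Only the last index wraps around under \<open>mod\<close>. Since
  \<open>1 / 0 = 0\<close>, splitting off its factor is valid even when some differences
  vanish.\<close>

lemma cyclic_fraction_cut:
  assumes "w \<noteq> []"
  shows "cyclic_fraction x w =
    1 / (x (last w) - x (hd w)) * (1 / (\<Prod>i < length w - 1. x (w ! i) - x (w ! Suc i)))"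
proof -
  obtain n where n: "length w = Suc n" using assms by (cases w) auto
  have "(\<Prod>i < length w. x (w ! i) - x (w ! (Suc i mod length w))) =
      (\<Prod>i < n. x (w ! i) - x (w ! Suc i)) * (x (w ! n) - x (w ! 0))"
    by (simp add: n)
  then show ?thesis
    using assms by (simp add: cyclic_fraction_def n last_conv_nth hd_conv_nth mult.commute)
qed

section \<open>Bounded posets\<close>

lemma linear_extensions_iff_sorted_wrt:
  "w \<in> linear_extensions V r \<longleftrightarrow>
    w \<in> permutations_of_set V \<and> sorted_wrt (\<lambda>i j. (j, i) \<notin> r) w"
  unfolding linear_extensions_def sorted_wrt_iff_nth_less mem_Collect_eq
  by (meson linorder_not_less order_less_trans)

locale bounded_poset =
  fixes V :: "'v set" and r :: "'v rel" and bmin bmax :: 'v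
  assumes finite: "finite V"
    and partial_order: "partial_order_on V r"
    and bmin: "bmin \<in> V" "\<And>v. v \<in> V \<Longrightarrow> (bmin, v) \<in> r"
    and bmax: "bmax \<in> V" "\<And>v. v \<in> V \<Longrightarrow> (v, bmax) \<in> r"
    and bmin_neq_bmax: "bmin \<noteq> bmax"
begin

text \<open>If \<open>bmax\<close> already covers \<open>bmin\<close>, \<open>insert\<close> changes
  nothing, so no parallel arc arises.\<close>

definition Q :: "'v rel" where "Q = insert (bmin, bmax) (hasse_diagram r)"

lemma r_props: "r \<subseteq> V \<times> V" "refl_on V r" "trans r" "antisym r" "finite r"
  using partial_order finite_subset[of r "V \<times> V"] finite
  by (auto simp: partial_order_on_def preorder_on_def)

lemma Q_subset: "Q \<subseteq> r"
  using bmin(2)[OF bmax(1)] hasse_diagram_subset by (auto simp: Q_def)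

lemma irrefl_Q: "irrefl Q"
  using bmin_neq_bmax by (auto simp: Q_def irrefl_def hasse_diagram_def)

lemma linear_extension_ends:
  assumes "w \<in> linear_extensions V r"
  shows "hd w = bmin" "last w = bmax"
proof -
  have w: "set w = V" "distinct w"
    and s: "\<And>a b. a < length w \<Longrightarrow> b < length w \<Longrightarrow> (w ! a, w ! b) \<in> r \<Longrightarrow> a \<le> b"
    using assms by (auto simp: linear_extensions_def permutations_of_set_def)
  then have ne: "w \<noteq> []" using bmin(1) by auto
  obtain a where a: "a < length w" "w ! a = bmin" using bmin(1) w by (metis in_set_conv_nth)
  \<comment> \<open>\<open>bmin\<close> lies below the entry at position 0, so its position is at
    most 0; the argument for \<open>bmax\<close> at the last position is dual.\<close>
  have "a = 0" using s[of a 0] a ne bmin(2) w nth_mem[of 0 w] by auto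
  then show "hd w = bmin" using a ne by (simp add: hd_conv_nth)
  obtain b where b: "b < length w" "w ! b = bmax" using bmax(1) w by (metis in_set_conv_nth)
  have "length w - 1 \<le> b"
    using s[of "length w - 1" b] b ne bmax(2) w nth_mem[of "length w - 1" w] by auto
  then have "b = length w - 1" using b(1) by simp
  then show "last w = bmax" using b ne by (simp add: last_conv_nth)
qed

lemma list_orientation_linear_extension:
  assumes "w \<in> linear_extensions V r"
  shows "list_orientation (underlying_graph Q) w = Q"
proof -
  have w: "set w = V" "distinct w" and s: "sorted_wrt (\<lambda>i j. (j, i) \<notin> r) w"
    using assms by (auto simp: linear_extensions_iff_sorted_wrt permutations_of_set_def)
  have "list_orientation (underlying_graph Q) w = Q \<inter> set w \<times> set w"
  proof (rule list_orientation_eq[OF _ irrefl_Q _ w(2)])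
    show "sorted_wrt (\<lambda>i j. (j, i) \<notin> Q) w"
      by (rule sorted_wrt_mono_rel[OF _ s]) (use Q_subset in auto)
  qed (auto simp: underlying_graph_def doubleton_eq_iff)
  then show ?thesis using w(1) Q_subset r_props(1) by auto
qed

text \<open>The added arc is what rigidifies the class: it ties the height at the bottom to the
  height at the top.\<close>

lemma toric_poset_source_bmin:
  assumes "E \<in> toric_poset V Q" "is_source V E bmin"
  shows "Q \<subseteq> E"
proof -
  obtain f :: "'v \<Rightarrow> int" where
    f: "\<And>i j. (i, j) \<in> Q \<Longrightarrow> f i = f j \<and> (i, j) \<in> E \<or> f i = f j + 1 \<and> (j, i) \<in> E"
    using toric_poset_height[OF assms(1)] by blast
  have anti: "f j \<le> f i" if "(i, j) \<in> r" for i j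
  proof -
    have "(i, j) \<in> (hasse_diagram r)\<^sup>*"
      using hasse_diagram_rtrancl[OF r_props(5,3,4) that] .
    then show ?thesis
    proof induction
      case (step j k)
      then show ?case using f[of j k] by (auto simp: Q_def)
    qed simp
  qed
  \<comment> \<open>The other alternative for this arc puts \<open>(bmax, bmin)\<close> into
    \<open>E\<close>, which a source at \<open>bmin\<close> excludes.\<close>
  have "f bmax = f bmin"
    using f[of bmin bmax] assms(2) by (auto simp: Q_def is_source_def)
  then have "f v = f bmin" if "v \<in> V" for v
    using anti[OF bmin(2)[OF that]] anti[OF bmax(2)[OF that]] by simp
  then have "f i = f j" if "(i, j) \<in> Q" for i j
    using that Q_subset r_props(1) by (metis (no_types) SigmaD1 SigmaD2 subsetD)
  then show ?thesis using f by fastforce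
qed

text \<open>The head \<open>bmin\<close> is a source of the orientation along \<open>u\<close>, so
  all arcs of \<open>Q\<close> survive. Hence covers ascend in \<open>u\<close>, and chains of
  covers give all of \<open>r\<close>.\<close>

lemma linear_extension_if_list_orientation:
  assumes "u \<in> permutations_of_set V" "hd u = bmin"
    and "list_orientation (underlying_graph Q) u \<in> toric_poset V Q"
  shows "u \<in> linear_extensions V r"
proof -
  let ?E = "list_orientation (underlying_graph Q) u"
  have u: "distinct u" "set u = V" using assms(1) by (auto simp: permutations_of_set_def)
  then obtain u' where u': "u = bmin # u'" using bmin(1) assms(2) by (cases u) auto
  have "is_source V ?E bmin"
    using u bmin(1) list_orientation_subset[of "underlying_graph Q" u']
    by (auto simp: is_source_def u')
  then have "Q \<subseteq> ?E" using toric_poset_source_bmin assms(3) by blast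
  moreover have index: "a < b" if "(u ! a, u ! b) \<in> list_orientation G u"
    "a < length u" "b < length u" for a b G
    using that u(1)
  proof (induction u arbitrary: a b)
    case (Cons v u)
    then show ?case using list_orientation_subset[of G u]
      by (cases a; cases b) auto
  qed simp
  ultimately have cover: "a < b"
    if "(u ! a, u ! b) \<in> hasse_diagram r" "a < length u" "b < length u" for a b
    using that by (auto simp: Q_def)
  have "a \<le> b" if ab: "(u ! a, u ! b) \<in> r" "a < length u" "b < length u" for a b
  proof -
    have "(u ! a, u ! b) \<in> (hasse_diagram r)\<^sup>*"
      using hasse_diagram_rtrancl[OF r_props(5,3,4) ab(1)] .
    \<comment> \<open>Quantifying over positions lets the induction run along a chain of elements,
      whose indices are recovered only when needed.\<close>
    then have "\<forall>c < length u. u ! c = u ! b \<longrightarrow> a \<le> c"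
    proof induction
      case base
      then show ?case using u(1) ab(2) by (simp add: nth_eq_iff_index_eq)
    next
      case (step y z)
      then have "y \<in> set u" using hasse_diagram_subset r_props(1) u(2) by blast
      then obtain c where c: "c < length u" "u ! c = y" by (auto simp: in_set_conv_nth)
      show ?case
      proof (intro allI impI)
        fix d assume "d < length u" "u ! d = z"
        then have "c < d" using cover[of c d] c step.hyps(2) by simp
        moreover have "a \<le> c" using step.IH c by blast
        ultimately show "a \<le> d" by simp
      qed
    qed
    then show ?thesis using ab(3) by simp
  qed
  then show ?thesis using assms(1) by (simp add: linear_extensions_def)
qed

lemma toric_total_extensions_eq:
  "toric_total_extensions V (toric_poset V Q) = toric_order ` linear_extensions V r"
proof -
  let ?C = "toric_poset V Q"
  have QV: "Q \<subseteq> V \<times> V" using Q_subset r_props(1) by (rule order_trans)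
  have iff: "toric_order_chamber V (toric_order w) \<subseteq> toric_chamber V ?C \<longleftrightarrow>
      (\<forall>u \<in> toric_order w. list_orientation (underlying_graph Q) u \<in> ?C)"
    if "w \<in> permutations_of_set V" for w
    using toric_order_subset_permutations[OF that] refl QV irrefl_Q
    by (rule toric_order_chamber_subset_iff)
  show ?thesis
  proof (intro equalityI subsetI)
    fix W assume "W \<in> toric_total_extensions V ?C"
    then obtain w where w: "w \<in> permutations_of_set V" "W = toric_order w"
      and "toric_order_chamber V W \<subseteq> toric_chamber V ?C"
      unfolding toric_total_extensions_def toric_total_orders_def by blast
    then have C: "\<forall>u \<in> W. list_orientation (underlying_graph Q) u \<in> ?C"
      using iff by blast
    \<comment> \<open>Among the rotations of \<open>w\<close>, the one starting at
      \<open>bmin\<close> is the candidate linear extension.\<close>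
    obtain m where m: "hd (rotate m w) = bmin"
      using ex_rotate_hd[of bmin w] w bmin(1) by (auto simp: permutations_of_set_def)
    have mW: "rotate m w \<in> W" by (auto simp: w(2) toric_order_def)
    then have "rotate m w \<in> permutations_of_set V"
      using toric_order_subset_permutations[OF w(1)] w(2) by auto
    then have "rotate m w \<in> linear_extensions V r"
      using m bspec[OF C mW] by (rule linear_extension_if_list_orientation)
    then show "W \<in> toric_order ` linear_extensions V r"
      by (rule rev_image_eqI) (simp add: w(2) toric_order_rotate)
  next
    fix W assume "W \<in> toric_order ` linear_extensions V r"
    then obtain w where w: "w \<in> linear_extensions V r" "W = toric_order w" by blast
    then have p: "w \<in> permutations_of_set V" by (simp add: linear_extensions_def)
    \<comment> \<open>The orientation along \<open>w\<close> is \<open>Q\<close> itself, and each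
      rotation is reached from it by flips.\<close>
    have "list_orientation (underlying_graph Q) (rotate m w) \<in> ?C" for m
      using list_orientation_rotate_in_toric_poset[of w V "underlying_graph Q" m] p
        list_orientation_linear_extension[OF w(1)]
      by (simp add: permutations_of_set_def)
    then have "toric_order_chamber V W \<subseteq> toric_chamber V ?C"
      unfolding w(2) iff[OF p] by (auto simp: toric_order_def)
    then show "W \<in> toric_total_extensions V ?C"
      using p w(2) by (simp add: toric_total_extensions_def toric_total_orders_def)
  qed
qed

theorem toric_greene_eq:
  fixes x :: "'v \<Rightarrow> 'k :: field"
  shows "toric_greene x V (toric_poset V Q) = 1 / (x bmax - x bmin) * greene x V r"
proof -
  \<comment> \<open>All linear extensions start at \<open>bmin\<close>, so distinct ones are never
    rotations of each other, and the toric sum can be reindexed by them.\<close>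
  have inj: "inj_on toric_order (linear_extensions V r)"
  proof (rule inj_onI)
    fix u w assume "u \<in> linear_extensions V r" "w \<in> linear_extensions V r"
      "toric_order u = toric_order w"
    moreover from this have "hd u = hd w" "distinct w"
      by (simp_all add: linear_extension_ends linear_extensions_def permutations_of_set_def)
    ultimately show "u = w" using toric_order_inj_hd by blast
  qed
  have "cyclic_fraction x w =
      1 / (x bmax - x bmin) * (1 / (\<Prod>i < length w - 1. x (w ! i) - x (w ! Suc i)))"
    if w: "w \<in> linear_extensions V r" for w
  proof -
    have "w \<noteq> []" using w bmin(1) by (auto simp: linear_extensions_def permutations_of_set_def)
    then show ?thesis using cyclic_fraction_cut[of w x] linear_extension_ends[OF w] by simp
  qed
  then show ?thesis
    by (simp add: toric_greene_def toric_total_extensions_eq sum.reindex[OF inj]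
        toric_fraction_toric_order greene_def sum_distrib_left)
qed

end

theorem proposition4p1:
  fixes V :: "'v set" and r Q :: "'v rel" and bmin bmax :: 'v
  assumes "finite V"
    and "partial_order_on V r"
    and "bmin \<in> V" and "\<forall>v \<in> V. (bmin, v) \<in> r"
    and "bmax \<in> V" and "\<forall>v \<in> V. (v, bmax) \<in> r"
    and "bmin \<noteq> bmax"
    and "Q = insert (bmin, bmax) (hasse_diagram r)"
  shows "(toric_greene indet V (toric_poset V Q) :: ('v, 'k :: field) ratfun) =
           1 / (indet bmax - indet bmin) * greene indet V r"
proof -
  interpret P: bounded_poset V r bmin bmax
    using assms by unfold_locales auto
  show ?thesis
    using P.toric_greene_eq by (simp only: assms(8) P.Q_def)
qed

end
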